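(* Let $(S,+)$ be an infinite semigroup (not necessarily commutative) and let $m$ be a natural number. Let $\mathcal{A}\subseteq [S]^{\infty}$ be a family containing an idempotent that is large for a sequence $\mathcal{R}_1,\mathcal{R}_2,\dotsc\subseteq \mathrm{Fin}(S)$; that is, there is an ultrafilter $e\in\beta S$ with $e+e=e$ and $e\subseteq\mathcal{A}$ such that for every $n$ each set in $e$ contains a set from $\mathcal{R}_n$. Let $\mathcal{B}\subseteq [S]^{\infty}$ be a family such that Alice has no winning strategy in the game $\mathsf{G}_{\mathrm{fin}}(\mathcal{A},\mathcal{B})$. Then for each coloring of $[S]^m$ there are finite families $\mathcal{F}_1\subseteq\mathcal{R}_1,\mathcal{F}_2\subseteq\mathcal{R}_2,\dotsc$, each nonempty and consisting of pairwise disjoint sets, and finite sets $F_1\subseteq\bigcup\mathcal{F}_1, F_2\subseteq\bigcup\mathcal{F}_2,\dotsc$ such that: (1) $\bigcup_{n\in\mathbb{N}}F_n\in\mathcal{B}$; (2) all sequences in the product $\bigcup\mathcal{F}_1\times\bigcup\mathcal{F}_2\times\dotsb$ are proper; (3) the partite $m$-sumgraph of the sequence $\bigcup\mathcal{F}_1,\bigcup\mathcal{F}_2,\dotsc$ is monochromatic. Moreover, if Alice has no winning strategy in the game $\mathsf{G}_1(\mathcal{A},\mathcal{B})$, then for each coloring of $[S]^m$ there are sets $R_1\in\mathcal{R}_1,R_2\in\mathcal{R}_2,\dotsc$ and elements $a_1\in R_1,a_2\in R_2,\dotsc$ such that: (1') $\{a_n : n\in\mathbb{N}\}\in\mathcal{B}$;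 (2') all sequences in the product $R_1\times R_2\times\dotsb$ are proper; (3') the partite $m$-sumgraph of the sequence $R_1,R_2,\dotsc$ is monochromatic.
   Context: Notation: $\mathbb{N}=\{1,2,\dotsc\}$. For a set $A$, $[A]^\infty$ is the family of all infinite subsets of $A$, $\mathrm{Fin}(A)$ is the family of all finite nonempty subsets of $A$, and $[A]^m$ is the family of all $m$-element subsets of $A$. A coloring of a nonempty set $X$ is a function $\chi\colon X\to\{1,\dotsc,k\}$ with $k$ a natural number; a set $A\subseteq X$ is monochromatic if $\chi$ is constant on $A$. For a semigroup $S$ with the discrete topology, $\beta S$ is the set of all ultrafilters on $S$, with the semigroup operation: $A\in p+q$ if and only if $\{b\in S : \exists C\in q\ (b+C\subseteq A)\}\in p$. An idempotent is an ultrafilter $e\in\beta S$ with $e+e=e$. A family $\mathcal{A}$ of nonempty sets is large for a family $\mathcal{R}$ of nonempty sets if every set in $\mathcal{A}$ contains a set in $\mathcal{R}$; it is large for a sequence $\mathcal{R}_1,\mathcal{R}_2,\dotsc$ if it is large for each $\mathcal{R}_n$. For $H_1,H_2\in\mathrm{Fin}(\mathbb{N})$ write $H_1<H_2$ if $\max H_1<\min H_2$. For a sequence $a_1,a_2,\dotsc$ in $S$ and $H=\{i_1<\dotsb<i_n\}\in\mathrm{Fin}(\mathbb{N})$ let $a_H:=a_{i_1}+\dotsb+a_{i_n}$. The sequence is proper if $a_{H_1}\neq a_{H_2}$ for all $H_1,H_2\in\mathrm{Fin}(\mathbb{N})$ with $H_1<H_2$. The $m$-sumgraph of a proper sequence is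 $\mathrm{SG}^m(a_1,a_2,\dotsc):=\{\{a_{H_1},\dotsc,a_{H_m}\} : H_1,\dotsc,H_m\in\mathrm{Fin}(\mathbb{N}),\ H_1<\dotsb<H_m\}$. The partite $m$-sumgraph of a sequence $F_1,F_2,\dotsc\in\mathrm{Fin}(S)$ such that all sequences in $F_1\times F_2\times\dotsb$ are proper is $\bigcup\{\mathrm{SG}^m(a_1,a_2,\dotsc) : (a_1,a_2,\dotsc)\in F_1\times F_2\times\dotsb\}$. Games (for nonempty families $\mathcal{A},\mathcal{B}$): in $\mathsf{G}_{\mathrm{fin}}(\mathcal{A},\mathcal{B})$, in each inning $n\in\mathbb{N}$ Alice chooses $A_n\in\mathcal{A}$ and then Bob replies with a finite set $F_n\subseteq A_n$; Bob wins if $\bigcup_{n}F_n\in\mathcal{B}$, otherwise Alice wins. In $\mathsf{G}_1(\mathcal{A},\mathcal{B})$, Alice chooses $A_n\in\mathcal{A}$ and Bob replies with an element $a_n\in A_n$; Bob wins if $\{a_n:n\in\mathbb{N}\}\in\mathcal{B}$, otherwise Alice wins. *)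

theory Defs
  imports Main "HOL-Library.FuncSet" "HOL-Library.Disjoint_Sets" "HOL-Library.Ramsey"
begin

text \<open>
  The semigroup \<open>S\<close> is a type of class \<open>semigroup_add\<close> (associative, not necessarily commutative).
  Sequences and innings are indexed by all of \<open>nat\<close>, starting at \<open>0\<close> instead of \<open>1\<close>;
  only the order of the index set matters.
\<close>

definition inf_subsets :: "'a set \<Rightarrow> 'a set set" where
  "inf_subsets A = {X. X \<subseteq> A \<and> infinite X}"

definition fin_subsets :: "'a set \<Rightarrow> 'a set set" where
  "fin_subsets A = {X. X \<subseteq> A \<and> finite X \<and> X \<noteq> {}}"

definition is_monochromatic :: "'x set \<Rightarrow> ('x \<Rightarrow> nat) \<Rightarrow> 'x set \<Rightarrow> bool" where
  "is_monochromatic X \<chi> A \<longleftrightarrow> A \<subseteq> X \<and> (\<exists>c. \<forall>x\<in>A. \<chi> x = c)"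


subsection \<open>Ultrafilters on a semigroup\<close>

definition is_ultrafilter :: "'a set set \<Rightarrow> bool" where
  "is_ultrafilter p \<longleftrightarrow>
     UNIV \<in> p \<and> {} \<notin> p \<and>
     (\<forall>A\<in>p. \<forall>B\<in>p. A \<inter> B \<in> p) \<and>
     (\<forall>A\<in>p. \<forall>B. A \<subseteq> B \<longrightarrow> B \<in> p) \<and>
     (\<forall>A. A \<in> p \<or> - A \<in> p)"

definition uf_add :: "'a::semigroup_add set set \<Rightarrow> 'a set set \<Rightarrow> 'a set set" where
  "uf_add p q = {A. {b. \<exists>C\<in>q. (\<lambda>c. b + c) ` C \<subseteq> A} \<in> p}"

definition idempotent_uf :: "'a::semigroup_add set set \<Rightarrow> bool" where
  "idempotent_uf e \<longleftrightarrow> is_ultrafilter e \<and> uf_add e e = e"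

definition large_for :: "'a set set \<Rightarrow> 'a set set \<Rightarrow> bool" where
  "large_for \<A> \<R> \<longleftrightarrow> (\<forall>A\<in>\<A>. \<exists>R\<in>\<R>. R \<subseteq> A)"


subsection \<open>Sumgraphs\<close>

definition block_less :: "nat set \<Rightarrow> nat set \<Rightarrow> bool" where
  "block_less H1 H2 \<longleftrightarrow> Max H1 < Min H2"

text \<open>
  A semigroup need not have a zero, so the sum along a finite nonempty \<open>H\<close>, taken in increasing
  order of the indices, starts with the first term; the value for other \<open>H\<close> is irrelevant.
\<close>

definition index_sum :: "(nat \<Rightarrow> 'a::semigroup_add) \<Rightarrow> nat set \<Rightarrow> 'a" where
  "index_sum a H =
     (case map a (sorted_list_of_set H) of [] \<Rightarrow> undefined | x # xs \<Rightarrow> foldl (+) x xs)"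

definition proper_seq :: "(nat \<Rightarrow> 'a::semigroup_add) \<Rightarrow> bool" where
  "proper_seq a \<longleftrightarrow>
     (\<forall>H1\<in>fin_subsets UNIV. \<forall>H2\<in>fin_subsets UNIV.
        block_less H1 H2 \<longrightarrow> index_sum a H1 \<noteq> index_sum a H2)"

definition sumgraph :: "nat \<Rightarrow> (nat \<Rightarrow> 'a::semigroup_add) \<Rightarrow> 'a set set" where
  "sumgraph m a =
     {(\<lambda>i. index_sum a (H i)) ` {1..m} | H :: nat \<Rightarrow> nat set.
        (\<forall>i\<in>{1..m}. H i \<in> fin_subsets UNIV) \<and> (\<forall>i\<in>{1..<m}. block_less (H i) (H (Suc i)))}"

definition partite_sumgraph :: "nat \<Rightarrow> (nat \<Rightarrow> 'a::semigroup_add set) \<Rightarrow> 'a set set" where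
  "partite_sumgraph m F = (\<Union>a\<in>Pi UNIV F. sumgraph m a)"


subsection \<open>Selection games\<close>

text \<open>
  A strategy for Alice assigns to each finite list of previous moves of Bob a member of \<open>\<A>\<close>.
  It is winning if she wins every play in which Bob's replies are legal.
\<close>

definition alice_wins_Gfin :: "'a set set \<Rightarrow> 'a set set \<Rightarrow> bool" where
  "alice_wins_Gfin \<A> \<B> \<longleftrightarrow>
     (\<exists>\<sigma> :: 'a set list \<Rightarrow> 'a set.
        (\<forall>h. \<sigma> h \<in> \<A>) \<and>
        (\<forall>F :: nat \<Rightarrow> 'a set.
           (\<forall>n. finite (F n) \<and> F n \<subseteq> \<sigma> (map F [0..<n])) \<longrightarrow> (\<Union>n. F n) \<notin> \<B>))"

definition alice_wins_G1 :: "'a set set \<Rightarrow> 'a set set \<Rightarrow> bool" where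
  "alice_wins_G1 \<A> \<B> \<longleftrightarrow>
     (\<exists>\<sigma> :: 'a list \<Rightarrow> 'a set.
        (\<forall>h. \<sigma> h \<in> \<A>) \<and>
        (\<forall>a :: nat \<Rightarrow> 'a. (\<forall>n. a n \<in> \<sigma> (map a [0..<n])) \<longrightarrow> range a \<notin> \<B>))"

end

theory Submission
  imports Defs
begin

text \<open>
  For an idempotent \<open>e\<close>, every \<open>B \<in> e\<close> contains a set \<open>A \<in> e\<close> with \<open>-b + A \<in> e\<close> for all \<open>b \<in> A\<close>
  (Galvin). Iterated limits along \<open>e\<close> extend the coloring of \<open>[S]\<^sup>m\<close> to all smaller sets; if \<open>c\<close> is
  the color of \<open>{}\<close>, then a set of color \<open>c\<close> retains this color when an \<open>e\<close>-typical element is added.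
  Alice plays such sets \<open>A\<^sub>0 \<supseteq> A\<^sub>1 \<supseteq> \<dots>\<close>, each shrunk so that \<open>u + A\<^sub>n\<^sub>+\<^sub>1 \<subseteq> A\<^sub>n\<close> for all \<open>u\<close> in the finite
  set chosen in inning \<open>n\<close>, and so that its elements are new and typical for the finitely many sums
  obtained before. Then sums over blocks starting at \<open>n\<close> lie in \<open>A\<^sub>n\<close>, and every play is as required,
  except that Bob might lose; but Alice's strategy is not winning. To cover Bob's moves by disjoint
  members of \<open>\<R>\<^sub>n\<close>, Alice actually plays the union of a maximal disjoint subfamily of
  \<open>{R \<in> \<R>\<^sub>n. R \<subseteq> A\<^sub>n}\<close>, which belongs to \<open>e\<close> because its complement contains no further such set.
\<close>

section \<open>Sums along finite index sets\<close>

lemma foldl_add_shift: "foldl (+) (x + y) zs = x + foldl (+) (y :: 'a::semigroup_add) zs"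
  by (induction zs arbitrary: y) (simp_all add: add.assoc)

lemma index_sum_singleton [simp]: "index_sum a {i} = a i"
  by (simp add: index_sum_def)

text \<open>Sums are bracketed to the left, so splitting off the first term takes
  associativity.\<close>

lemma index_sum_insert_less:
  assumes "finite H" "H \<noteq> {}" "\<And>j. j \<in> H \<Longrightarrow> i < j"
  shows "index_sum a (insert i H) = a i + index_sum a H"
proof -
  have "sorted_list_of_set (insert i H) = i # sorted_list_of_set H"
    using assms by (intro sorted_distinct_set_unique)
      (auto simp: less_imp_le simp del: sorted_list_of_set_insert_remove)
  moreover obtain x xs where "map a (sorted_list_of_set H) = x # xs"
    using assms by (cases "map a (sorted_list_of_set H)") auto
  ultimately show ?thesis
    by (simp add: index_sum_def foldl_add_shift)
qed

lemma index_sum_insert_greater: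
  assumes "finite H" "H \<noteq> {}" "\<And>j. j \<in> H \<Longrightarrow> j < i"
  shows "index_sum a (insert i H) = index_sum a H + a i"
proof -
  have "sorted_list_of_set (insert i H) = sorted_list_of_set H @ [i]"
    using assms by (intro sorted_distinct_set_unique) (auto simp: sorted_append less_imp_le
      simp del: sorted_list_of_set_insert_remove)
  moreover obtain x xs where "map a (sorted_list_of_set H) = x # xs"
    using assms by (cases "map a (sorted_list_of_set H)") auto
  ultimately show ?thesis
    by (simp add: index_sum_def)
qed

section \<open>Ultrafilters and shift-stable members of idempotents\<close>

lemma uf_mono: "is_ultrafilter p \<Longrightarrow> A \<in> p \<Longrightarrow> A \<subseteq> B \<Longrightarrow> B \<in> p"
  unfolding is_ultrafilter_def by blast

lemma uf_Int: "is_ultrafilter p \<Longrightarrow> A \<in> p \<Longrightarrow> B \<in> p \<Longrightarrow> A \<inter> B \<in> p"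
  unfolding is_ultrafilter_def by blast

lemma uf_disjoint: "is_ultrafilter p \<Longrightarrow> A \<in> p \<Longrightarrow> B \<in> p \<Longrightarrow> A \<inter> B \<noteq> {}"
  unfolding is_ultrafilter_def by metis

lemma uf_INT:
  assumes "is_ultrafilter p" "finite I" "\<And>i. i \<in> I \<Longrightarrow> f i \<in> p"
  shows "(\<Inter>i\<in>I. f i) \<in> p"
  using assms(2,3)
proof (induction I)
  case empty
  then show ?case using assms(1) by (simp add: is_ultrafilter_def)
next
  case (insert i I)
  then show ?case using uf_Int[OF assms(1)] by simp
qed

lemma uf_UN:
  assumes "is_ultrafilter p" "finite I" "(\<Union>i\<in>I. f i) \<in> p"
  shows "\<exists>i\<in>I. f i \<in> p"
proof (rule ccontr)
  assume "\<not> ?thesis"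
  then have "\<And>i. i \<in> I \<Longrightarrow> - f i \<in> p"
    using assms(1) unfolding is_ultrafilter_def by blast
  then have "(\<Inter>i\<in>I. - f i) \<in> p" by (rule uf_INT[OF assms(1,2)])
  from uf_disjoint[OF assms(1) assms(3) this] show False by blast
qed

lemma uf_Compl_finite:
  assumes "is_ultrafilter p" "\<And>A. A \<in> p \<Longrightarrow> infinite A" "finite F"
  shows "- F \<in> p"
  using assms unfolding is_ultrafilter_def by blast

text \<open>Upward closure lets the largest candidate for C stand for all of them.\<close>

lemma uf_add_iff:
  assumes "is_ultrafilter q"
  shows "A \<in> uf_add p q \<longleftrightarrow> {b. {c. b + c \<in> A} \<in> q} \<in> p"
proof -
  have "(\<exists>C\<in>q. (+) b ` C \<subseteq> A) \<longleftrightarrow> {c. b + c \<in> A} \<in> q" for b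
  proof
    assume "\<exists>C\<in>q. (+) b ` C \<subseteq> A"
    then obtain C where "C \<in> q" "C \<subseteq> {c. b + c \<in> A}" by blast
    then show "{c. b + c \<in> A} \<in> q" by (rule uf_mono[OF assms])
  qed (auto intro!: bexI[of _ "{c. b + c \<in> A}"])
  then show ?thesis by (simp add: uf_add_def)
qed

definition shift_stable :: "'a::semigroup_add set set \<Rightarrow> 'a set \<Rightarrow> bool" where
  "shift_stable p A \<longleftrightarrow> (\<forall>b\<in>A. {c. b + c \<in> A} \<in> p)"

text \<open>Let star C be the set of all b in C with -b + C in e. As e + e = e, star C is in e
  whenever C is. Take A = star B: for b in A, associativity gives -b + star B = star (-b + B), which
  is in e.\<close>

lemma shift_stable_subset:
  assumes "idempotent_uf e" "B \<in> e"
  obtains A where "A \<in> e" "A \<subseteq> B" "shift_stable e A"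
proof -
  have uf: "is_ultrafilter e" using assms(1) by (simp add: idempotent_uf_def)
  have star: "{b\<in>C. {c. b + c \<in> C} \<in> e} \<in> e" if "C \<in> e" for C
  proof -
    have "{b. {c. b + c \<in> C} \<in> e} \<in> e"
      using assms(1) that uf_add_iff[OF uf, of C e] by (simp add: idempotent_uf_def)
    from uf_Int[OF uf that this] show ?thesis by (simp add: Int_def)
  qed
  let ?A = "{b\<in>B. {c. b + c \<in> B} \<in> e}"
  have "{c. b + c \<in> ?A} \<in> e" if "b \<in> ?A" for b
    using star[of "{c. b + c \<in> B}"] that by (simp add: add.assoc)
  then have "shift_stable e ?A" unfolding shift_stable_def by blast
  then show ?thesis using star[OF assms(2)] that[of ?A] by blast
qed

section \<open>Iterated limits of the coloring and typical elements\<close>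

text \<open>
  \<open>persists e P r D\<close> says that \<open>P\<close> holds at \<open>D\<close> enlarged by \<open>r\<close> new points, each of them
  \<open>e\<close>-typical over the preceding ones.
\<close>

primrec persists :: "'a set set \<Rightarrow> ('a set \<Rightarrow> bool) \<Rightarrow> nat \<Rightarrow> 'a set \<Rightarrow> bool" where
  "persists e P 0 D \<longleftrightarrow> P D"
| "persists e P (Suc r) D \<longleftrightarrow> {x. x \<notin> D \<and> persists e P r (insert x D)} \<in> e"

text \<open>Off the finite set D, each x has some color over \<open>insert x D\<close>. So finitely
  many color classes cover \<open>- D\<close>, which is in e, and one of them is in e.\<close>

lemma persists_color_exists:
  assumes "is_ultrafilter e" "\<And>A. A \<in> e \<Longrightarrow> infinite A"
    and "\<chi> \<in> nsets UNIV (r + card D) \<rightarrow> {1..k::nat}" "finite D"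
  shows "\<exists>c\<in>{1..k}. persists e (\<lambda>D. \<chi> D = c) r D"
  using assms(3,4)
proof (induction r arbitrary: D)
  case 0
  then show ?case by (auto simp: nsets_def)
next
  case (Suc r)
  have "\<exists>c\<in>{1..k}. persists e (\<lambda>D. \<chi> D = c) r (insert x D)" if "x \<notin> D" for x
    using Suc.IH[of "insert x D"] Suc.prems that by simp
  then have "- D \<subseteq> (\<Union>c\<in>{1..k}. {x. x \<notin> D \<and> persists e (\<lambda>D. \<chi> D = c) r (insert x D)})"
    by blast
  from uf_UN[OF assms(1) finite_atLeastAtMost
      uf_mono[OF assms(1) uf_Compl_finite[OF assms(1,2) Suc.prems(2)] this]]
  show ?case by simp
qed

text \<open>The equation \<open>card D + Suc r = m\<close> lets D determine r, so a finite T imposes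
  only finitely many conditions.\<close>

definition fresh :: "'a set set \<Rightarrow> ('a set \<Rightarrow> bool) \<Rightarrow> nat \<Rightarrow> 'a set \<Rightarrow> 'a set" where
  "fresh e P m T = {x. x \<notin> T \<and>
     (\<forall>D r. D \<subseteq> T \<longrightarrow> card D + Suc r = m \<longrightarrow> persists e P (Suc r) D \<longrightarrow>
        persists e P r (insert x D))}"

lemma fresh_in_uf:
  assumes uf: "is_ultrafilter e" and inf: "\<And>A. A \<in> e \<Longrightarrow> infinite A" and T: "finite T"
  shows "fresh e P m T \<in> e"
proof -
  let ?I = "{(D, r). D \<subseteq> T \<and> card D + Suc r = m \<and> persists e P (Suc r) D}"
  let ?f = "\<lambda>(D, r). {x. x \<notin> D \<and> persists e P r (insert x D)}"
  have "?I \<subseteq> Pow T \<times> {..m}" by auto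
  then have "finite ?I" by (rule finite_subset) (simp add: T)
  \<comment> \<open>Each factor is in e by the second equation of \<open>persists\<close>.\<close>
  then have "(\<Inter>i\<in>?I. ?f i) \<in> e" by (rule uf_INT[OF uf]) auto
  from uf_Int[OF uf uf_Compl_finite[OF uf inf T] this] show ?thesis
    by (rule uf_mono[OF uf]) (auto simp: fresh_def)
qed

section \<open>States of a play and the sums they control\<close>

text \<open>
  The state \<open>(A, T)\<close> of a play: Alice is about to play inside \<open>A\<close>, and \<open>T\<close> contains all sums of the
  points chosen so far.
\<close>

definition admissible ::
  "'a::semigroup_add set set \<Rightarrow> ('a set \<Rightarrow> bool) \<Rightarrow> nat \<Rightarrow> 'a set \<times> 'a set \<Rightarrow> bool" where
  "admissible e P m = (\<lambda>(A, T). A \<in> e \<and> shift_stable e A \<and> finite T \<and> A \<subseteq> fresh e P m T)"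

text \<open>U holds all candidates for the term of the inning. The clause on u + c serves to put a
  first term before later sums, the clause on t + u to put a last term after earlier sums.\<close>

definition advances :: "'a::semigroup_add set \<Rightarrow> 'a set \<times> 'a set \<Rightarrow> 'a set \<times> 'a set \<Rightarrow> bool" where
  "advances U s s' \<longleftrightarrow> U \<subseteq> fst s \<and> fst s' \<subseteq> fst s \<and> (\<forall>u\<in>U. \<forall>c\<in>fst s'. u + c \<in> fst s) \<and>
     snd s \<union> U \<union> {t + u |t u. t \<in> snd s \<and> u \<in> U} \<subseteq> snd s'"

lemma admissible_initial:
  assumes "idempotent_uf e" "\<And>A. A \<in> e \<Longrightarrow> infinite A"
  shows "\<exists>A. admissible e P m (A, {})"
proof -
  have uf: "is_ultrafilter e" using assms(1) by (simp add: idempotent_uf_def)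
  obtain A where "A \<in> e" "A \<subseteq> fresh e P m {}" "shift_stable e A"
    using shift_stable_subset[OF assms(1) fresh_in_uf[OF uf assms(2) finite.emptyI]] .
  then show ?thesis unfolding admissible_def by auto
qed

text \<open>Shift stability puts -u + A into e for each u in U. Intersecting these finitely many
  sets with A and the fresh elements stays in e, and a shift-stable subset is the next set.\<close>

lemma admissible_advance:
  assumes "idempotent_uf e" "\<And>A. A \<in> e \<Longrightarrow> infinite A"
    and s: "admissible e P m s" and U: "finite U" "U \<subseteq> fst s"
  shows "\<exists>s'. admissible e P m s' \<and> advances U s s'"
proof -
  have uf: "is_ultrafilter e" using assms(1) by (simp add: idempotent_uf_def)
  obtain A T where [simp]: "s = (A, T)" by force
  have A: "A \<in> e" "shift_stable e A" and T: "finite T"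
    using s by (auto simp: admissible_def)
  define T' where "T' = T \<union> U \<union> {t + u |t u. t \<in> T \<and> u \<in> U}"
  have "{t + u |t u. t \<in> T \<and> u \<in> U} = (\<lambda>(t, u). t + u) ` (T \<times> U)" by auto
  then have T': "finite T'" using T U by (simp add: T'_def)
  have "(\<Inter>u\<in>U. {c. u + c \<in> A}) \<in> e"
    using A U by (intro uf_INT[OF uf]) (auto simp: shift_stable_def)
  then have "fresh e P m T' \<inter> (A \<inter> (\<Inter>u\<in>U. {c. u + c \<in> A})) \<in> e"
    using fresh_in_uf[OF uf assms(2) T'] A uf_Int[OF uf] by blast
  then obtain A' where "A' \<in> e" "A' \<subseteq> fresh e P m T' \<inter> (A \<inter> (\<Inter>u\<in>U. {c. u + c \<in> A}))"
    "shift_stable e A'"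
    using shift_stable_subset[OF assms(1)] by metis
  then have "admissible e P m (A', T')" "advances U s (A', T')"
    using T' U unfolding admissible_def advances_def T'_def by auto
  then show ?thesis by blast
qed

text \<open>As + need not commute, membership in \<open>fst\<close> is shown by adding a least index
  on the left, membership in \<open>snd\<close> by adding a greatest index on the right.\<close>

lemma sums_of_run:
  assumes adv: "\<And>n. advances (U n) (s n) (s (Suc n))" and a: "a \<in> Pi UNIV U"
  shows tail_sum_in_run: "\<lbrakk>finite H; H \<noteq> {}; \<And>i. i \<in> H \<Longrightarrow> l \<le> i\<rbrakk> \<Longrightarrow> index_sum a H \<in> fst (s l)"
    and head_sum_in_run: "\<lbrakk>finite H; H \<noteq> {}; \<And>i. i \<in> H \<Longrightarrow> i < l\<rbrakk> \<Longrightarrow> index_sum a H \<in> snd (s l)"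
    and snd_run_mono: "k \<le> l \<Longrightarrow> snd (s k) \<subseteq> snd (s l)"
proof -
  have adv': "U n \<subseteq> fst (s n)" "fst (s (Suc n)) \<subseteq> fst (s n)"
    "\<And>u c. u \<in> U n \<Longrightarrow> c \<in> fst (s (Suc n)) \<Longrightarrow> u + c \<in> fst (s n)"
    "snd (s n) \<subseteq> snd (s (Suc n))" "U n \<subseteq> snd (s (Suc n))"
    "\<And>t u. t \<in> snd (s n) \<Longrightarrow> u \<in> U n \<Longrightarrow> t + u \<in> snd (s (Suc n))" for n
    using adv[of n] unfolding advances_def by simp_all blast
  have decr: "fst (s l) \<subseteq> fst (s k)" if "k \<le> l" for k l
    using that adv'(2) by (rule lift_Suc_antimono_le[rotated])
  have incr: "snd (s k) \<subseteq> snd (s l)" if "k \<le> l" for k l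
    using adv'(4) that by (rule lift_Suc_mono_le)
  have aU: "a i \<in> U i" for i using a by blast
  show "index_sum a H \<in> fst (s l)" if "finite H" "H \<noteq> {}" "\<And>i. i \<in> H \<Longrightarrow> l \<le> i"
    using that
  proof (induction H arbitrary: l rule: finite_linorder_min_induct)
    case empty
    then show ?case by simp
  next
    case (insert i H)
    have "index_sum a (insert i H) \<in> fst (s i)"
    proof (cases "H = {}")
      case True
      then show ?thesis using aU[of i] adv'(1) by auto
    next
      case False
      then have "index_sum a H \<in> fst (s (Suc i))" using insert by (simp add: Suc_le_eq)
      then show ?thesis
        using insert False aU adv'(3) by (simp add: index_sum_insert_less)
    qed
    then show ?case using decr[of l i] insert.prems by blast
  qed
  show "index_sum a H \<in> snd (s l)" if "finite H" "H \<noteq> {}" "\<And>i. i \<in> H \<Longrightarrow> i < l"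
    using that
  proof (induction H arbitrary: l rule: finite_linorder_max_induct)
    case empty
    then show ?case by simp
  next
    case (insert i H)
    have "index_sum a (insert i H) \<in> snd (s (Suc i))"
    proof (cases "H = {}")
      case True
      then show ?thesis using aU[of i] adv'(5) by auto
    next
      case False
      then have "index_sum a H \<in> snd (s i)" using insert by simp
      then have "index_sum a H + a i \<in> snd (s (Suc i))"
        using aU adv'(6) by blast
      then show ?thesis using insert False by (simp add: index_sum_insert_greater)
    qed
    then show ?case using incr[of "Suc i" l] insert.prems by (auto simp: Suc_le_eq)
  qed
  show "snd (s k) \<subseteq> snd (s l)" if "k \<le> l" using incr that .
qed

text \<open>Once a block has ended, its sum is recorded in T, and every sum over a later block is
  fresh over this T. Hence the two differ, and adjoining block sums one by one lowers the counter of
  \<open>persists\<close> from m to 0, where it says P.\<close>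

lemma run_proper_and_sumgraph:
  assumes adm: "\<And>n. admissible e P m (s n)" and adv: "\<And>n. advances (U n) (s n) (s (Suc n))"
    and P: "persists e P m {}" and a: "a \<in> Pi UNIV U"
  shows "proper_seq a" "sumgraph m a \<subseteq> {D \<in> nsets UNIV m. P D}"
proof -
  note tail = tail_sum_in_run[OF adv a] and head = head_sum_in_run[OF adv a]
  note mono = snd_run_mono[OF adv a]
  have fresh: "fst (s n) \<subseteq> fresh e P m (snd (s n))" for n
    using adm[of n] by (auto simp: admissible_def case_prod_beta)
  have head_Max: "index_sum a H \<in> snd (s (Suc (Max H)))" if "H \<in> fin_subsets UNIV" for H
    using that by (intro head) (auto simp: fin_subsets_def less_Suc_eq_le)
  have tail_Min: "index_sum a H \<in> fresh e P m (snd (s n))"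
    if "H \<in> fin_subsets UNIV" "n \<le> Min H" for H n
    using that by (intro subsetD[OF fresh] tail) (auto simp: fin_subsets_def)
  show "proper_seq a"
    unfolding proper_seq_def
  proof (intro ballI impI)
    fix H1 H2 :: "nat set"
    assume H: "H1 \<in> fin_subsets UNIV" "H2 \<in> fin_subsets UNIV" "block_less H1 H2"
    have "index_sum a H2 \<notin> snd (s (Suc (Max H1)))"
      using tail_Min[of H2 "Suc (Max H1)"] H by (auto simp: fresh_def block_less_def)
    then show "index_sum a H1 \<noteq> index_sum a H2" using head_Max[OF H(1)] by auto
  qed
  show "sumgraph m a \<subseteq> {D \<in> nsets UNIV m. P D}"
  proof
    fix E assume "E \<in> sumgraph m a"
    then obtain H where E: "E = (\<lambda>i. index_sum a (H i)) ` {1..m}"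
      and H: "\<And>i. i \<in> {1..m} \<Longrightarrow> H i \<in> fin_subsets UNIV"
      and less: "\<And>i. i \<in> {1..<m} \<Longrightarrow> block_less (H i) (H (Suc i))"
      unfolding sumgraph_def by blast
    define D where "D j = (\<lambda>i. index_sum a (H i)) ` {1..j}" for j
    \<comment> \<open>The first inning after the last index of block j, or 0 before any block is
      used.\<close>
    define l where "l j = (if j = 0 then 0 else Suc (Max (H j)))" for j
    have "card (D j) = j \<and> D j \<subseteq> snd (s (l j)) \<and> persists e P (m - j) (D j)" if "j \<le> m" for j
      using that
    proof (induction j)
      case 0
      then show ?case using P by (simp add: D_def)
    next
      case (Suc j)
      define x where "x = index_sum a (H (Suc j))"
      have IH: "card (D j) = j" "D j \<subseteq> snd (s (l j))" "persists e P (m - j) (D j)"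
        using Suc by auto
      have D: "D (Suc j) = insert x (D j)"
        by (simp add: D_def x_def atLeastAtMostSuc_conv)
      have Hj: "H (Suc j) \<in> fin_subsets UNIV" using H Suc.prems by simp
      have lj: "l j \<le> Min (H (Suc j))"
        using less[of j] Suc.prems by (auto simp: l_def block_less_def)
      have x: "x \<in> fresh e P m (snd (s (l j)))"
        using tail_Min[OF Hj lj] by (simp add: x_def)
      then have "x \<notin> D j" using IH by (auto simp: fresh_def)
      then have "card (D (Suc j)) = Suc j" using IH by (simp add: D) (simp add: D_def)
      moreover have "persists e P (m - Suc j) (insert x (D j))"
      proof -
        \<comment> \<open>Brings the counter into the form \<open>Suc r\<close> that
          \<open>fresh\<close> uses.\<close>
        have m: "Suc (m - Suc j) = m - j" using Suc.prems by simp
        show ?thesis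
          using x IH Suc.prems unfolding fresh_def m[symmetric] by auto
      qed
      moreover have "D (Suc j) \<subseteq> snd (s (l (Suc j)))"
      proof -
        have "Min (H (Suc j)) \<le> Max (H (Suc j))"
          using Hj by (simp add: fin_subsets_def)
        then have "snd (s (l j)) \<subseteq> snd (s (l (Suc j)))"
          using lj by (intro mono) (simp add: l_def)
        moreover have "x \<in> snd (s (l (Suc j)))" using head_Max[OF Hj] by (simp add: l_def x_def)
        ultimately show ?thesis using IH(2) unfolding D by blast
      qed
      ultimately show ?case by (simp add: D)
    qed
    from this[of m] show "E \<in> {D \<in> nsets UNIV m. P D}"
      by (simp add: E D_def nsets_def)
  qed
qed

section \<open>Disjoint families with union in the ultrafilter\<close>

lemma maximal_disjoint_subfamily:
  assumes uf: "is_ultrafilter e" and large: "large_for e \<R>" and ne: "{} \<notin> \<R>" and A: "A \<in> e"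
  obtains \<M> where "\<M> \<subseteq> \<R>" "disjoint \<M>" "\<Union>\<M> \<subseteq> A" "\<Union>\<M> \<in> e"
proof -
  let ?Z = "{\<M>. \<M> \<subseteq> \<R> \<and> disjoint \<M> \<and> \<Union>\<M> \<subseteq> A}"
  have "\<Union>\<C> \<in> ?Z" if "\<C> \<in> chains ?Z" for \<C>
  proof -
    \<comment> \<open>Any two sets in the union of the chain lie together in the larger of the
      families they come from.\<close>
    have "disjoint (\<Union>\<C>)"
      unfolding disjoint_def
    proof (intro ballI impI)
      fix X Y assume XY: "X \<in> \<Union>\<C>" "Y \<in> \<Union>\<C>" "X \<noteq> Y"
      from XY obtain \<N>1 \<N>2 where "\<N>1 \<in> \<C>" "X \<in> \<N>1" "\<N>2 \<in> \<C>" "Y \<in> \<N>2" by blast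
      moreover have "\<N>1 \<subseteq> \<N>2 \<or> \<N>2 \<subseteq> \<N>1"
        using that calculation by (auto simp: chains_def chain_subset_def)
      ultimately obtain \<N> where \<N>: "\<N> \<in> \<C>" "X \<in> \<N>" "Y \<in> \<N>" by blast
      then have "disjoint \<N>" using that by (auto simp: chains_def)
      then show "X \<inter> Y = {}" using \<N> XY(3) by (simp add: disjoint_def)
    qed
    then show ?thesis using that unfolding chains_def by auto
  qed
  then obtain \<M> where M: "\<M> \<in> ?Z" and max: "\<And>\<N>. \<N> \<in> ?Z \<Longrightarrow> \<M> \<subseteq> \<N> \<Longrightarrow> \<N> = \<M>"
    using Zorn_Lemma[of ?Z] by auto
  have "\<Union>\<M> \<in> e"
  proof (rule ccontr)
    assume "\<Union>\<M> \<notin> e"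
    then have "- \<Union>\<M> \<in> e" using uf by (auto simp: is_ultrafilter_def)
    then obtain R where R: "R \<in> \<R>" "R \<subseteq> A \<inter> - \<Union>\<M>"
      using large uf_Int[OF uf A] unfolding large_for_def by blast
    \<comment> \<open>R avoids the union of \<M>, so the enlarged family is still disjoint;
      maximality puts R into \<M>, which leaves only R empty.\<close>
    then have "insert R \<M> \<in> ?Z"
      using M by (auto simp: disjoint_def pairwise_insert disjnt_def)
    then have "R \<in> \<M>" using max by blast
    then have "R = {}" using R(2) by blast
    then show False using R(1) ne by simp
  qed
  then show ?thesis using M that by blast
qed

text \<open>Bob may choose the empty set, so a member M of \<M> is inserted into the finite cover to
  make it nonempty.\<close>

lemma finite_disjoint_cover:
  assumes "disjoint \<M>" "\<M> \<noteq> {}" "finite F" "F \<subseteq> \<Union>\<M>"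
  obtains \<F> where "\<F> \<subseteq> \<M>" "finite \<F>" "\<F> \<noteq> {}" "disjoint \<F>" "F \<subseteq> \<Union>\<F>"
proof -
  obtain \<G> where G: "\<G> \<subseteq> \<M>" "finite \<G>" "F \<subseteq> \<Union>\<G>"
    using finite_subset_Union[OF assms(3,4)] by metis
  obtain M where "M \<in> \<M>" using assms(2) by blast
  with G show ?thesis
    using pairwise_subset[OF assms(1), of "insert M \<G>"]
    by (intro that[of "insert M \<G>"]) auto
qed

section \<open>Strategies that depend on a remembered state\<close>

text \<open>
  \<open>Q\<close> is an invariant of the state that Alice remembers, and \<open>T\<close> its admissible changes.
  After an illegal move of Bob the state is kept, so that all moves of Alice remain in \<open>\<A>\<close>.
\<close>

lemma strategy_with_memory:
  fixes legal :: "'x \<Rightarrow> 'b \<Rightarrow> bool" and Q :: "'s \<Rightarrow> bool"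
    and T :: "nat \<Rightarrow> 's \<Rightarrow> 'b \<Rightarrow> 's \<Rightarrow> bool"
  assumes Q_init: "Q init"
    and step: "\<forall>n s. Q s \<longrightarrow> (\<exists>X\<in>\<A>. \<forall>F. legal X F \<longrightarrow> (\<exists>s'. Q s' \<and> T n s F s'))"
  shows "\<exists>\<sigma> :: 'b list \<Rightarrow> 'x. (\<forall>h. \<sigma> h \<in> \<A>) \<and>
    (\<forall>f. (\<forall>n. legal (\<sigma> (map f [0..<n])) (f n)) \<longrightarrow>
      (\<exists>s. \<forall>n. Q (s n) \<and> T n (s n) (f n) (s (Suc n))))"
proof -
  obtain X where X: "\<And>n s. Q s \<Longrightarrow> X n s \<in> \<A>"
    "\<And>n s F. Q s \<Longrightarrow> legal (X n s) F \<Longrightarrow> \<exists>s'. Q s' \<and> T n s F s'"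
  \<comment> \<open>Alice's move is chosen from the inning and the state alone; only the next state
    may depend on F.\<close>
  proof (rule that[of "\<lambda>n s. SOME X. X \<in> \<A> \<and> (\<forall>F. legal X F \<longrightarrow> (\<exists>s'. Q s' \<and> T n s F s'))"])
    fix n s assume "Q s"
    from someI_ex[OF step[rule_format, OF this, of n, unfolded Bex_def]]
    show "(SOME X. X \<in> \<A> \<and> (\<forall>F. legal X F \<longrightarrow> (\<exists>s'. Q s' \<and> T n s F s'))) \<in> \<A>"
      and "\<And>F. legal (SOME X. X \<in> \<A> \<and> (\<forall>F. legal X F \<longrightarrow> (\<exists>s'. Q s' \<and> T n s F s'))) F \<Longrightarrow>
        \<exists>s'. Q s' \<and> T n s F s'"
      by blast+
  qed
  define nxt where
    "nxt n s F = (if \<exists>s'. Q s' \<and> T n s F s' then SOME s'. Q s' \<and> T n s F s' else s)" for n s F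
  have nxt: "Q (nxt n s F)" if "Q s" for n s F
    using that someI_ex[of "\<lambda>s'. Q s' \<and> T n s F s'"] by (auto simp: nxt_def)
  have nxtT: "T n s F (nxt n s F)" if "Q s" "legal (X n s) F" for n s F
    using X(2)[OF that] someI_ex[of "\<lambda>s'. Q s' \<and> T n s F s'"] by (auto simp: nxt_def)
  \<comment> \<open>Reversing makes the latest move the outermost one, so the tail h holds the
    earlier moves and its length is the inning.\<close>
  define st where "st h = rec_list init (\<lambda>F h s. nxt (length h) s F) (rev h)" for h
  have st: "st [] = init" "st (h @ [F]) = nxt (length h) (st h) F" for h F
    by (simp_all add: st_def)
  have Qst: "Q (st h)" for h
    by (induction h rule: rev_induct) (simp_all add: st Q_init nxt)
  show ?thesis
  proof (intro exI[of _ "\<lambda>h. X (length h) (st h)"] conjI allI impI)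
    show "X (length h) (st h) \<in> \<A>" for h using X(1) Qst .
    fix f assume "\<forall>n. legal (X (length (map f [0..<n])) (st (map f [0..<n]))) (f n)"
    then show "\<exists>s. \<forall>n. Q (s n) \<and> T n (s n) (f n) (s (Suc n))"
      using Qst by (intro exI[of _ "\<lambda>n. st (map f [0..<n])"]) (simp add: st nxtT)
  qed
qed

section \<open>From the two games to monochromatic partite sumgraphs\<close>

theorem theorem2p2:
  fixes \<A> \<B> :: "'a::semigroup_add set set"
    and \<R> :: "nat \<Rightarrow> 'a set set"
    and m :: nat
  assumes "infinite (UNIV :: 'a set)"
    and "m \<ge> 1"
    and "\<A> \<subseteq> inf_subsets UNIV"
    and "\<And>n. \<R> n \<subseteq> fin_subsets UNIV"
    and "\<exists>e. idempotent_uf e \<and> e \<subseteq> \<A> \<and> (\<forall>n. large_for e (\<R> n))"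
    and "\<B> \<subseteq> inf_subsets UNIV"
  shows "(\<not> alice_wins_Gfin \<A> \<B> \<longrightarrow>
           (\<forall>(k::nat) (\<chi> :: 'a set \<Rightarrow> nat). \<chi> \<in> nsets UNIV m \<rightarrow> {1..k} \<longrightarrow>
             (\<exists>(\<F> :: nat \<Rightarrow> 'a set set) (F :: nat \<Rightarrow> 'a set).
                (\<forall>n. \<F> n \<subseteq> \<R> n \<and> finite (\<F> n) \<and> \<F> n \<noteq> {} \<and> disjoint (\<F> n)) \<and>
                (\<forall>n. finite (F n) \<and> F n \<subseteq> \<Union>(\<F> n)) \<and>
                (\<Union>n. F n) \<in> \<B> \<and>
                (\<forall>a\<in>Pi UNIV (\<lambda>n. \<Union>(\<F> n)). proper_seq a) \<and>
                is_monochromatic (nsets UNIV m) \<chi> (partite_sumgraph m (\<lambda>n. \<Union>(\<F> n)))))) \<and>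
         (\<not> alice_wins_G1 \<A> \<B> \<longrightarrow>
           (\<forall>(k::nat) (\<chi> :: 'a set \<Rightarrow> nat). \<chi> \<in> nsets UNIV m \<rightarrow> {1..k} \<longrightarrow>
             (\<exists>(R :: nat \<Rightarrow> 'a set) (a :: nat \<Rightarrow> 'a).
                (\<forall>n. R n \<in> \<R> n \<and> a n \<in> R n) \<and>
                range a \<in> \<B> \<and>
                (\<forall>b\<in>Pi UNIV R. proper_seq b) \<and>
                is_monochromatic (nsets UNIV m) \<chi> (partite_sumgraph m R))))"
proof -
  obtain e where e: "idempotent_uf e" "e \<subseteq> \<A>" and large: "\<And>n. large_for e (\<R> n)"
    using assms(5) by blast
  have uf: "is_ultrafilter e" using e(1) by (simp add: idempotent_uf_def)
  have inf: "infinite A" if "A \<in> e" for A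
    using that e(2) assms(3) by (auto simp: inf_subsets_def)
  have fin: "finite R" "R \<noteq> {}" if "R \<in> \<R> n" for R n
    using that assms(4)[of n] by (auto simp: fin_subsets_def)
  have family: "\<exists>\<M>. \<M> \<subseteq> \<R> n \<and> disjoint \<M> \<and> \<Union>\<M> \<subseteq> fst s \<and> \<Union>\<M> \<in> e"
    if "admissible e P m s" for P n s
  proof -
    have "{} \<notin> \<R> n" "fst s \<in> e"
      using fin(2) that by (auto simp: admissible_def case_prod_beta)
    from maximal_disjoint_subfamily[OF uf large this] show ?thesis by metis
  qed
  have mono: "(\<forall>a\<in>Pi UNIV U. proper_seq a) \<and> is_monochromatic (nsets UNIV m) \<chi> (partite_sumgraph m U)"
    if "\<And>n. admissible e (\<lambda>D. \<chi> D = c) m (s n)" "\<And>n. advances (U n) (s n) (s (Suc n))"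
      "persists e (\<lambda>D. \<chi> D = c) m {}" for \<chi> c s U
    using run_proper_and_sumgraph[where P = "\<lambda>D. \<chi> D = c" and s = s and U = U, OF that]
    unfolding is_monochromatic_def partite_sumgraph_def by blast
  have color: "\<exists>c. persists e (\<lambda>D. \<chi> D = c) m {}" if "\<chi> \<in> nsets UNIV m \<rightarrow> {1..k}" for \<chi> and k :: nat
    using persists_color_exists[OF uf inf, of \<chi> m "{}" k] that by auto
  show ?thesis
  proof (intro conjI impI allI)
    fix k :: nat and \<chi> :: "'a set \<Rightarrow> nat"
    assume game: "\<not> alice_wins_Gfin \<A> \<B>" and "\<chi> \<in> nsets UNIV m \<rightarrow> {1..k}"
    then obtain c where c: "persists e (\<lambda>D. \<chi> D = c) m {}" using color by blast
    let ?Q = "admissible e (\<lambda>D. \<chi> D = c) m"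
    \<comment> \<open>The whole union of \<F> advances the state, not just Bob's F, so that one run
      controls all sequences in the product.\<close>
    let ?T = "\<lambda>n s F s'. \<exists>\<F>. \<F> \<subseteq> \<R> n \<and> finite \<F> \<and> \<F> \<noteq> {} \<and> disjoint \<F> \<and> F \<subseteq> \<Union>\<F> \<and>
      advances (\<Union>\<F>) s s'"
    obtain A0 where init: "?Q (A0, {})"
      using admissible_initial[OF e(1) inf] by blast
    have step: "\<forall>n s. ?Q s \<longrightarrow>
      (\<exists>X\<in>\<A>. \<forall>F. finite F \<and> F \<subseteq> X \<longrightarrow> (\<exists>s'. ?Q s' \<and> ?T n s F s'))"
    proof (intro allI impI)
      fix n s assume s: "?Q s"
      obtain \<M> where M: "\<M> \<subseteq> \<R> n" "disjoint \<M>" "\<Union>\<M> \<subseteq> fst s" "\<Union>\<M> \<in> e"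
        using family[OF s] by blast
      have "\<M> \<noteq> {}" using inf[OF M(4)] by auto
      have "\<exists>s'. ?Q s' \<and> ?T n s F s'" if F: "finite F" "F \<subseteq> \<Union>\<M>" for F
      proof -
        obtain \<F> where \<F>: "\<F> \<subseteq> \<M>" "finite \<F>" "\<F> \<noteq> {}" "disjoint \<F>" "F \<subseteq> \<Union>\<F>"
          using finite_disjoint_cover[OF M(2) \<open>\<M> \<noteq> {}\<close> F] .
        have "finite (\<Union>\<F>)" "\<Union>\<F> \<subseteq> fst s" using \<F> M fin(1) by blast+
        from admissible_advance[OF e(1) inf s this] show ?thesis using \<F> M(1) by blast
      qed
      then show "\<exists>X\<in>\<A>. \<forall>F. finite F \<and> F \<subseteq> X \<longrightarrow> (\<exists>s'. ?Q s' \<and> ?T n s F s')"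
        using M(4) e(2) by blast
    qed
    obtain \<sigma> where \<sigma>: "\<forall>h. \<sigma> h \<in> \<A>"
      "\<forall>f. (\<forall>n. finite (f n) \<and> f n \<subseteq> \<sigma> (map f [0..<n])) \<longrightarrow>
        (\<exists>s. \<forall>n. ?Q (s n) \<and> ?T n (s n) (f n) (s (Suc n)))"
      using strategy_with_memory[where Q = ?Q and T = ?T and \<A> = \<A> and init = "(A0, {})"
          and legal = "\<lambda>X F. finite F \<and> F \<subseteq> X", OF init step]
      by (elim exE conjE)
    \<comment> \<open>As \<sigma> is not winning, Bob wins some legal play against it.\<close>
    obtain F where F: "\<forall>n. finite (F n) \<and> F n \<subseteq> \<sigma> (map F [0..<n])" "(\<Union>n. F n) \<in> \<B>"
      using game \<sigma>(1) unfolding alice_wins_Gfin_def by blast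
    from \<sigma>(2)[rule_format, OF F(1)[rule_format]] obtain s where s: "\<And>n. ?Q (s n)" "\<And>n. ?T n (s n) (F n) (s (Suc n))"
      by blast
    from s(2) obtain \<F> where \<F>: "\<And>n. \<F> n \<subseteq> \<R> n \<and> finite (\<F> n) \<and> \<F> n \<noteq> {} \<and> disjoint (\<F> n)"
      "\<And>n. F n \<subseteq> \<Union>(\<F> n)" "\<And>n. advances (\<Union>(\<F> n)) (s n) (s (Suc n))"
      by metis
    show "\<exists>\<F> F. (\<forall>n. \<F> n \<subseteq> \<R> n \<and> finite (\<F> n) \<and> \<F> n \<noteq> {} \<and> disjoint (\<F> n)) \<and>
        (\<forall>n. finite (F n) \<and> F n \<subseteq> \<Union>(\<F> n)) \<and> (\<Union>n. F n) \<in> \<B> \<and>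
        (\<forall>a\<in>Pi UNIV (\<lambda>n. \<Union>(\<F> n)). proper_seq a) \<and>
        is_monochromatic (nsets UNIV m) \<chi> (partite_sumgraph m (\<lambda>n. \<Union>(\<F> n)))"
      using \<F>(1,2) F mono[of \<chi> c s "\<lambda>n. \<Union>(\<F> n)", OF s(1) \<F>(3) c]
      by (intro exI[of _ \<F>] exI[of _ F]) simp
  next
    fix k :: nat and \<chi> :: "'a set \<Rightarrow> nat"
    assume game: "\<not> alice_wins_G1 \<A> \<B>" and "\<chi> \<in> nsets UNIV m \<rightarrow> {1..k}"
    then obtain c where c: "persists e (\<lambda>D. \<chi> D = c) m {}" using color by blast
    let ?Q = "admissible e (\<lambda>D. \<chi> D = c) m"
    let ?T = "\<lambda>n s x s'. \<exists>R. R \<in> \<R> n \<and> x \<in> R \<and> advances R s s'"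
    obtain A0 where init: "?Q (A0, {})"
      using admissible_initial[OF e(1) inf] by blast
    have step: "\<forall>n s. ?Q s \<longrightarrow> (\<exists>X\<in>\<A>. \<forall>x. x \<in> X \<longrightarrow> (\<exists>s'. ?Q s' \<and> ?T n s x s'))"
    proof (intro allI impI)
      fix n s assume s: "?Q s"
      obtain \<M> where M: "\<M> \<subseteq> \<R> n" "\<Union>\<M> \<subseteq> fst s" "\<Union>\<M> \<in> e"
        using family[OF s] by metis
      have "\<exists>s'. ?Q s' \<and> ?T n s x s'" if x: "x \<in> \<Union>\<M>" for x
      proof -
        \<comment> \<open>Here one member of \<M> containing x takes the place of the finite
          cover.\<close>
        obtain R where R: "x \<in> R" "R \<in> \<M>" using x by blast
        have "finite R" "R \<subseteq> fst s" using R M fin(1) by blast+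
        from admissible_advance[OF e(1) inf s this] show ?thesis using R M(1) by blast
      qed
      then show "\<exists>X\<in>\<A>. \<forall>x. x \<in> X \<longrightarrow> (\<exists>s'. ?Q s' \<and> ?T n s x s')"
        using M(3) e(2) by (intro bexI[of _ "\<Union>\<M>"] allI impI) (assumption, rule subsetD)
    qed
    obtain \<sigma> where \<sigma>: "\<forall>h. \<sigma> h \<in> \<A>"
      "\<forall>f. (\<forall>n. f n \<in> \<sigma> (map f [0..<n])) \<longrightarrow>
        (\<exists>s. \<forall>n. ?Q (s n) \<and> ?T n (s n) (f n) (s (Suc n)))"
      using strategy_with_memory[where Q = ?Q and T = ?T and \<A> = \<A> and init = "(A0, {})"
          and legal = "\<lambda>X x. x \<in> X", OF init step]
      by (elim exE conjE)
    obtain a where a: "\<forall>n. a n \<in> \<sigma> (map a [0..<n])" "range a \<in> \<B>"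
      using game \<sigma>(1) unfolding alice_wins_G1_def by blast
    from \<sigma>(2)[rule_format, OF a(1)[rule_format]] obtain s where s: "\<And>n. ?Q (s n)" "\<And>n. ?T n (s n) (a n) (s (Suc n))"
      by blast
    from s(2) obtain R where R: "\<And>n. R n \<in> \<R> n \<and> a n \<in> R n"
      "\<And>n. advances (R n) (s n) (s (Suc n))"
      by metis
    show "\<exists>R a. (\<forall>n. R n \<in> \<R> n \<and> a n \<in> R n) \<and> range a \<in> \<B> \<and>
        (\<forall>b\<in>Pi UNIV R. proper_seq b) \<and>
        is_monochromatic (nsets UNIV m) \<chi> (partite_sumgraph m R)"
      using R(1) a(2) mono[of \<chi> c s R, OF s(1) R(2) c] by (intro exI[of _ R] exI[of _ a]) simp
  qed
qed

end
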